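(* Let $p$ be a positive integer. Suppose that $\Lambda_1,\dots,\Lambda_{p-1}\ge 0$. Let $$f(z)=\prod_{k=0}^{p-1}\big(a_k(z)\big)^{\bar z^k}$$ be a log-$p$-analytic function satisfying $f(0)=\lambda_f(0)=1$. Suppose that for each $k\in\{0,1,\dots,p-1\}$ we have that (i) $a_k(z)$ is log-analytic in $U$, $a_k(0)=a_k'(0)=1$, and $A_k(z):=\log a_k(z)$; (ii) for each $k\in\{1,\dots,p-1\}$, $|A_k'(z)|\le\Lambda_k$, and $|A_0'(z)|\le 1$, for all $z\in U$. Then $f$ is univalent in $U_{\rho_2}$, where $$\rho_2=\begin{cases}1,&\text{if }\sum_{k=1}^{p-1}(k+1)\Lambda_k\le 1,\\ \rho_2',&\text{if }\sum_{k=1}^{p-1}(k+1)\Lambda_k>1,\end{cases}$$ and $\rho_2'$ is the unique root in $(0,1)$ of the equation $$1-\sum_{k=1}^{p-1}(k+1)\Lambda_kr^k=0.$$ Moreover, the range $f(U_{\rho_2})$ contains a schlicht disk $U(w_2,r_2)$, where $$\sigma_2=\rho_2-\sum_{k=1}^{p-1}\Lambda_k\rho_2^{k+1}$$ and $$w_2=\cosh\sigma_2,\qquad r_2=\sinh\sigma_2.$$ This result is sharp.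
   Context: For $r>0$, $U_r=\{z\in\mathbb C:|z|<r\}$, $U=U_1$, and $U(w,r)=\{\zeta\in\mathbb C:|\zeta-w|<r\}$. A continuous complex-valued function $F$ on a domain $D\subset\mathbb C$ is poly-analytic of order $p$ if $\partial^pF/\partial\bar z^p=0$ in $D$. A function $f$ is log-$p$-analytic in $D$ if $\log f$ is poly-analytic of order $p$ in $D$; log-analytic means log-$1$-analytic. Here $\log$ is taken to be its principal branch such that $\log 1=0$. The power is $(a_k(z))^{\bar z^k}=\exp(\bar z^k\log a_k(z))$. For a continuously differentiable $f$, $\lambda_f(z)=\big||f_z(z)|-|f_{\bar z}(z)|\big|$. Univalent means injective. A schlicht disk in the range of $f$ is a disk that is the univalent image under $f$ of some region. Empty sums are $0$.
   Formalization: Sharpness fails in general if a_k'(0)=1 for all k (empty class if p=2, Λ_1=1/2); it is proved there for p=1 or p=2, Λ_1=1, and for all p, Λ_k when only a_0'(0)=1 is required (the rest of the theorem also holds then). log is the continuous branch with log 1=0. *)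

theory Defs
  imports "HOL-Complex_Analysis.Complex_Analysis"
begin

definition wirtinger_z :: "(complex \<Rightarrow> complex) \<Rightarrow> complex \<Rightarrow> complex" where
  "wirtinger_z f z =
     (frechet_derivative f (at z) 1 - \<i> * frechet_derivative f (at z) \<i>) / 2"

definition wirtinger_zbar :: "(complex \<Rightarrow> complex) \<Rightarrow> complex \<Rightarrow> complex" where
  "wirtinger_zbar f z =
     (frechet_derivative f (at z) 1 + \<i> * frechet_derivative f (at z) \<i>) / 2"

definition lambda_f :: "(complex \<Rightarrow> complex) \<Rightarrow> complex \<Rightarrow> real" where
  "lambda_f f z = \<bar>cmod (wirtinger_z f z) - cmod (wirtinger_zbar f z)\<bar>"

(* Differentiability is real (Frechet) differentiability; it makes all the
   iterated derivatives up to order p meaningful. D is meant to be open and connected. *)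
definition polyanalytic_on :: "nat \<Rightarrow> (complex \<Rightarrow> complex) \<Rightarrow> complex set \<Rightarrow> bool" where
  "polyanalytic_on p F D \<longleftrightarrow>
     continuous_on D F \<and>
     (\<forall>j<p. \<forall>z\<in>D. (wirtinger_zbar ^^ j) F differentiable (at z)) \<and>
     (\<forall>z\<in>D. (wirtinger_zbar ^^ p) F z = 0)"

(* L is "log f" on the domain D, which contains 0: the continuous branch taking the principal
   value at 0, hence L 0 = 0 when f 0 = 1. The composition Ln o f is such a branch whenever it
   is continuous on D, but f is allowed to cross the cut of Ln: otherwise functions such as
   exp (c * z) on the unit disk would be excluded for large c. *)
definition is_log_on :: "complex set \<Rightarrow> (complex \<Rightarrow> complex) \<Rightarrow> (complex \<Rightarrow> complex) \<Rightarrow> bool" where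
  "is_log_on D f L \<longleftrightarrow>
     continuous_on D L \<and> (\<forall>z\<in>D. exp (L z) = f z) \<and> L 0 = Ln (f 0)"

definition log_polyanalytic_on :: "nat \<Rightarrow> (complex \<Rightarrow> complex) \<Rightarrow> complex set \<Rightarrow> bool" where
  "log_polyanalytic_on p f D \<longleftrightarrow> (\<exists>L. is_log_on D f L \<and> polyanalytic_on p L D)"

abbreviation log_analytic_on :: "(complex \<Rightarrow> complex) \<Rightarrow> complex set \<Rightarrow> bool" where
  "log_analytic_on \<equiv> log_polyanalytic_on 1"

(* The disk U(w,r) is the univalent image under f of some region contained in S. *)
definition contains_schlicht_disk ::
    "(complex \<Rightarrow> complex) \<Rightarrow> complex set \<Rightarrow> complex \<Rightarrow> real \<Rightarrow> bool" where
  "contains_schlicht_disk f S w r \<longleftrightarrow>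
     0 < r \<and>
     (\<exists>\<Omega>. open \<Omega> \<and> connected \<Omega> \<and> \<Omega> \<subseteq> S \<and> inj_on f \<Omega> \<and> f ` \<Omega> = ball w r)"

(* f = prod_k a_k ^ (cnj z ^ k) with A_k = log a_k. The set N collects the indices k for which
   the normalization a_k'(0) = 1 is imposed. N = {..<p} imposes it for every k; since
   A_k'(0) = a_k'(0), this forces Lam k >= 1 for 1 <= k < p. N = {0} imposes it for k = 0 only. *)
definition landau_class ::
    "nat set \<Rightarrow> nat \<Rightarrow> (nat \<Rightarrow> real) \<Rightarrow>
     (nat \<Rightarrow> complex \<Rightarrow> complex) \<Rightarrow> (nat \<Rightarrow> complex \<Rightarrow> complex) \<Rightarrow> (complex \<Rightarrow> complex) \<Rightarrow> bool" where
  "landau_class N p Lam a A f \<longleftrightarrow>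
     log_polyanalytic_on p f (ball 0 1) \<and>
     (\<forall>z\<in>ball 0 1. f z = (\<Prod>k<p. exp (cnj z ^ k * A k z))) \<and>
     f 0 = 1 \<and> lambda_f f 0 = 1 \<and>
     (\<forall>k<p. log_analytic_on (a k) (ball 0 1) \<and> is_log_on (ball 0 1) (a k) (A k) \<and> a k 0 = 1) \<and>
     (\<forall>k\<in>N. deriv (a k) 0 = 1) \<and>
     (\<forall>k\<in>{1..<p}. \<forall>z\<in>ball 0 1. cmod (deriv (A k) z) \<le> Lam k) \<and>
     (\<forall>z\<in>ball 0 1. cmod (deriv (A 0) z) \<le> 1)"

definition rho2 :: "nat \<Rightarrow> (nat \<Rightarrow> real) \<Rightarrow> real" where
  "rho2 p Lam =
     (if (\<Sum>k\<in>{1..<p}. real (k + 1) * Lam k) \<le> 1 then 1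
      else (THE r. 0 < r \<and> r < 1 \<and> 1 - (\<Sum>k\<in>{1..<p}. real (k + 1) * Lam k * r ^ k) = 0))"

definition sigma2 :: "nat \<Rightarrow> (nat \<Rightarrow> real) \<Rightarrow> real" where
  "sigma2 p Lam = rho2 p Lam - (\<Sum>k\<in>{1..<p}. Lam k * rho2 p Lam ^ (k + 1))"

definition w2 :: "nat \<Rightarrow> (nat \<Rightarrow> real) \<Rightarrow> complex" where
  "w2 p Lam = of_real (cosh (sigma2 p Lam))"

definition r2 :: "nat \<Rightarrow> (nat \<Rightarrow> real) \<Rightarrow> real" where
  "r2 p Lam = sinh (sigma2 p Lam)"

definition landau_conclusion :: "nat \<Rightarrow> (nat \<Rightarrow> real) \<Rightarrow> (complex \<Rightarrow> complex) \<Rightarrow> bool" where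
  "landau_conclusion p Lam f \<longleftrightarrow>
     inj_on f (ball 0 (rho2 p Lam)) \<and>
     contains_schlicht_disk f (ball 0 (rho2 p Lam)) (w2 p Lam) (r2 p Lam)"

(* f shows that neither radius can be enlarged. Functions live on the unit disk, so the first
   part is vacuous when rho2 = 1. *)
definition landau_extremal :: "nat \<Rightarrow> (nat \<Rightarrow> real) \<Rightarrow> (complex \<Rightarrow> complex) \<Rightarrow> bool" where
  "landau_extremal p Lam f \<longleftrightarrow>
     (\<forall>r. rho2 p Lam < r \<and> r \<le> 1 \<longrightarrow> \<not> inj_on f (ball 0 r)) \<and>
     (\<forall>r. r2 p Lam < r \<longrightarrow> \<not> ball (w2 p Lam) r \<subseteq> f ` ball 0 (rho2 p Lam))"

end

theory Submission
  imports Defs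
begin

text \<open>
  Since \<open>|A\<^sub>0'| \<le> 1 = A\<^sub>0'(0)\<close>, the maximum principle gives \<open>A\<^sub>0(z) = z\<close>, so \<open>log f\<close> is a perturbation
  of the identity whose Lipschitz constant on the closed disk of radius \<open>t\<close> is at most
  \<open>\<Sum> (k+1) \<Lambda>\<^sub>k t^k\<close>. This is less than 1 for \<open>t < \<rho>\<^sub>2\<close>, hence \<open>log f\<close> is injective on \<open>U\<close> of radius
  \<open>\<rho>\<^sub>2\<close>, and Banach's fixed point theorem shows that it covers the disk of radius \<open>\<sigma>\<^sub>2\<close>. Its values
  have modulus below \<open>3/2 < \<pi>\<close>, where \<open>exp\<close> is injective, and \<open>exp\<close> maps the disk of radius \<open>\<sigma>\<close>
  onto a superset of the disk with diameter from \<open>exp (-\<sigma>)\<close> to \<open>exp \<sigma>\<close>. Taking all \<open>A\<^sub>k\<close> linear gives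
  functions for which \<open>log f\<close> is real on the real axis and all these estimates are attained there.
\<close>

section \<open>The exponential image of a disk\<close>

lemma mult_cos_le_sin:
  fixes t :: real
  assumes "0 \<le> t" "t \<le> pi"
  shows "t * cos t \<le> sin t"
proof -
  have "sin 0 - 0 * cos 0 \<le> sin t - t * cos t"
  proof (rule DERIV_nonneg_imp_nondecreasing[OF assms(1)])
    fix x assume x: "0 \<le> x" "x \<le> t"
    have "((\<lambda>x. sin x - x * cos x) has_real_derivative x * sin x) (at x)"
      by (auto intro!: derivative_eq_intros)
    moreover have "0 \<le> x * sin x"
      using x assms by (intro mult_nonneg_nonneg sin_ge_zero) auto
    ultimately show "\<exists>y. ((\<lambda>x. sin x - x * cos x) has_real_derivative y) (at x) \<and> 0 \<le> y"
      by blast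
  qed
  then show ?thesis by simp
qed

lemma sinh_le_mult_cosh:
  fixes s :: real
  assumes "0 \<le> s"
  shows "sinh s \<le> s * cosh s"
proof -
  have "0 * cosh 0 - sinh 0 \<le> s * cosh s - sinh s"
  proof (rule DERIV_nonneg_imp_nondecreasing[OF assms])
    fix x assume x: "0 \<le> x" "x \<le> s"
    have "((\<lambda>x. x * cosh x - sinh x) has_real_derivative x * sinh x) (at x)"
      by (auto intro!: derivative_eq_intros)
    moreover have "0 \<le> x * sinh x"
      using x by simp
    ultimately show "\<exists>y. ((\<lambda>x. x * cosh x - sinh x) has_real_derivative y) (at x) \<and> 0 \<le> y"
      by blast
  qed
  then show ?thesis by simp
qed

text \<open>Both sides agree at \<open>y = 0\<close>, and the left side decreases in
  \<open>y\<close>: with \<open>s\<close> the square root, the sign of its derivative reduces to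
  \<open>t * cos t \<le> sin t\<close> and \<open>sinh s \<le> s * cosh s\<close>.\<close>

lemma cos_mult_cosh_le:
  fixes x y :: real
  assumes "0 \<le> y" "y \<le> pi"
  shows "cos y * cosh (sqrt (x\<^sup>2 + y\<^sup>2)) \<le> cosh x"
proof -
  \<comment> \<open>Only interior points are differentiated, because for \<open>x = 0\<close> the
    square root has a kink at 0.\<close>
  have "cos y * cosh (sqrt (x\<^sup>2 + y\<^sup>2)) \<le> cos 0 * cosh (sqrt (x\<^sup>2 + 0\<^sup>2))"
  proof (rule DERIV_nonpos_imp_decreasing_open[OF assms(1)])
    fix t assume t: "0 < t" "t < y"
    define s where "s = sqrt (x\<^sup>2 + t\<^sup>2)"
    have pos: "0 < x\<^sup>2 + t\<^sup>2" using t by (simp add: add_nonneg_pos)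
    then have s: "0 < s" by (simp add: s_def)
    have "((\<lambda>t. cos t * cosh (sqrt (x\<^sup>2 + t\<^sup>2))) has_real_derivative
        (- sin t * cosh s + cos t * sinh s * (t / s))) (at t)"
      using pos s by (auto intro!: derivative_eq_intros simp: s_def field_simps)
    moreover have "- sin t * cosh s + cos t * sinh s * (t / s) \<le> 0"
    proof -
      have "t * cos t * sinh s \<le> sin t * sinh s"
        using mult_cos_le_sin[of t] t assms s by (intro mult_right_mono) auto
      also have "\<dots> \<le> sin t * (s * cosh s)"
        using sinh_le_mult_cosh[of s] t assms s by (intro mult_left_mono sin_ge_zero) auto
      finally show ?thesis using s by (simp add: field_simps)
    qed
    ultimately show "\<exists>y. ((\<lambda>t. cos t * cosh (sqrt (x\<^sup>2 + t\<^sup>2))) has_real_derivative y) (at t) \<and> y \<le> 0"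
      by blast
  qed (auto intro!: continuous_intros)
  then show ?thesis by simp
qed

text \<open>The disk has the diameter from \<open>exp (-\<sigma>)\<close> to
  \<open>exp \<sigma>\<close>. Squaring its inequality and dividing by \<open>2 * exp x\<close>,
  where \<open>exp x\<close> is the modulus of \<open>w\<close>, gives
  \<open>cosh x < cos y * cosh \<sigma>\<close>. By \<open>cos_mult_cosh_le\<close> this is
  incompatible with \<open>cmod (Ln w) \<ge> \<sigma>\<close>.\<close>

lemma norm_Ln_less:
  assumes w: "w \<in> ball (complex_of_real (cosh \<sigma>)) (sinh \<sigma>)"
  shows "w \<noteq> 0" "cmod (Ln w) < \<sigma>"
proof -
  have d: "cmod (w - cosh \<sigma>) < sinh \<sigma>"
    using w by (simp add: dist_norm norm_minus_commute)
  have "0 < sinh \<sigma>"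
    by (rule le_less_trans[OF norm_ge_zero d])
  then have \<sigma>: "0 < \<sigma>"
    by simp
  have "cosh \<sigma> - Re w \<le> cmod (w - cosh \<sigma>)"
    using abs_Re_le_cmod[of "w - cosh \<sigma>"] by simp
  then have Re: "0 < Re w"
    using d sinh_less_cosh_real[of \<sigma>] by linarith
  then show w0: "w \<noteq> 0" by auto
  define x y where "x = Re (Ln w)" and "y = \<bar>Im (Ln w)\<bar>"
  have y: "0 \<le> y" "y \<le> pi"
    using Re_Ln_pos_lt[OF w0] Re by (auto simp: y_def)
  have mod: "cmod w = exp x"
    using w0 by (simp add: x_def)
  have Rew: "Re w = exp x * cos y"
    using exp_Ln[OF w0] Re_exp[of "Ln w"] by (auto simp: x_def y_def)
  have "(cmod (w - cosh \<sigma>))\<^sup>2 < (sinh \<sigma>)\<^sup>2"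
    using d by (intro power_strict_mono) auto
  moreover have "(cmod (w - cosh \<sigma>))\<^sup>2 = (cmod w)\<^sup>2 - 2 * Re w * cosh \<sigma> + (cosh \<sigma>)\<^sup>2"
    by (simp only: cmod_power2) (simp add: power2_eq_square algebra_simps)
  ultimately have "(exp x)\<^sup>2 + 1 < 2 * (exp x * cos y) * cosh \<sigma>"
    unfolding mod Rew by (simp add: cosh_square_eq)
  moreover have "2 * exp x * cosh x = (exp x)\<^sup>2 + 1"
    by (simp add: cosh_field_def exp_minus field_simps power2_eq_square)
  ultimately have "2 * exp x * cosh x < 2 * exp x * (cos y * cosh \<sigma>)"
    by (simp add: mult.assoc)
  then have less: "cosh x < cos y * cosh \<sigma>"
    by simp
  show "cmod (Ln w) < \<sigma>"
  proof (rule ccontr)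
    assume "\<not> ?thesis"
    then have "cosh \<sigma> \<le> cosh (cmod (Ln w))"
      using \<sigma> by (simp add: cosh_real_nonneg_le_iff)
    \<comment> \<open>Otherwise the right side of \<open>less\<close> would be nonpositive. The sign
      permits multiplying the inequality of hyperbolic cosines by \<open>cos y\<close>.\<close>
    moreover have "0 < cos y"
      using less cosh_real_pos[of x] cosh_real_pos[of \<sigma>] by (smt (verit) mult_nonpos_nonneg)
    ultimately have "cos y * cosh \<sigma> \<le> cos y * cosh (cmod (Ln w))"
      by simp
    also have "\<dots> \<le> cosh x"
      using cos_mult_cosh_le[OF y, of x] by (simp add: cmod_def x_def y_def)
    finally show False using less by simp
  qed
qed

section \<open>The radius\<close>

locale landau_weights =
  fixes p :: nat and Lam :: "nat \<Rightarrow> real"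
  assumes Lam_nonneg: "k \<in> {1..<p} \<Longrightarrow> 0 \<le> Lam k"
begin

text \<open>This will be the Lipschitz constant of \<open>log f - id\<close> on the closed disk of
  radius \<open>t\<close>; the equation for the radius reads \<open>slope r = 1\<close>.\<close>

definition slope :: "real \<Rightarrow> real" where
  "slope t = (\<Sum>k\<in>{1..<p}. real (k + 1) * Lam k * t ^ k)"

text \<open>A lower bound for the modulus of \<open>log f\<close> on the circle of radius
  \<open>t\<close>. Its derivative is \<open>1 - slope t\<close>, so it increases up to the critical
  radius.\<close>

definition height :: "real \<Rightarrow> real" where
  "height t = t - (\<Sum>k\<in>{1..<p}. Lam k * t ^ (k + 1))"

abbreviation "\<rho> \<equiv> rho2 p Lam"
abbreviation "\<sigma> \<equiv> sigma2 p Lam"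

lemma sigma_eq: "\<sigma> = height \<rho>"
  by (simp add: sigma2_def height_def)

lemma continuous_on_slope [continuous_intros]: "continuous_on S slope"
  unfolding slope_def[abs_def] by (intro continuous_intros)

lemma continuous_on_height [continuous_intros]: "continuous_on S height"
  unfolding height_def[abs_def] by (intro continuous_intros)

lemma has_real_derivative_height: "(height has_real_derivative 1 - slope t) (at t)"
proof -
  have "((\<lambda>t. Lam k * t ^ (k + 1)) has_real_derivative real (k + 1) * Lam k * t ^ k) (at t)" for k
    using DERIV_cmult[OF DERIV_pow[of "k + 1" t UNIV], of "Lam k"] by (simp add: ac_simps)
  then show ?thesis
    unfolding height_def[abs_def] slope_def by (intro DERIV_diff DERIV_ident DERIV_sum)
qed

lemma slope_0 [simp]: "slope 0 = 0"
  by (auto simp: slope_def intro!: sum.neutral)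

lemma height_0 [simp]: "height 0 = 0"
  by (simp add: height_def)

lemma slope_nonneg: "0 \<le> t \<Longrightarrow> 0 \<le> slope t"
  unfolding slope_def by (intro sum_nonneg mult_nonneg_nonneg Lam_nonneg) auto

text \<open>Only powers with \<open>k \<ge> 1\<close> occur, so \<open>slope t / t\<close> is
  nondecreasing; the product form also covers \<open>t = 0\<close>.\<close>

lemma slope_scale:
  assumes "0 \<le> t" "t \<le> u"
  shows "u * slope t \<le> t * slope u"
  unfolding slope_def sum_distrib_left
proof (rule sum_mono)
  fix k assume k: "k \<in> {1..<p}"
  then obtain m where m: "k = Suc m"
    by (cases k) auto
  have "t ^ m \<le> u ^ m"
    using assms by (intro power_mono)
  moreover have "0 \<le> t * u"
    using assms by simp
  ultimately have "(t * u) * t ^ m \<le> (t * u) * u ^ m"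
    by (rule mult_left_mono)
  then have "real (k + 1) * Lam k * (u * t ^ k) \<le> real (k + 1) * Lam k * (t * u ^ k)"
    using Lam_nonneg[OF k] by (intro mult_left_mono) (auto simp: m ac_simps)
  then show "u * (real (k + 1) * Lam k * t ^ k) \<le> t * (real (k + 1) * Lam k * u ^ k)"
    by (simp add: ac_simps)
qed

lemma slope_strict_mono:
  assumes "0 \<le> t" "t < u" "0 < slope u"
  shows "slope t < slope u"
proof -
  have "u * slope t \<le> t * slope u"
    using assms by (intro slope_scale) auto
  also have "\<dots> < u * slope u"
    using assms by (intro mult_strict_right_mono) auto
  finally show ?thesis using assms by (simp add: mult_less_cancel_left_disj)
qed

lemma ex1_root:
  assumes "1 < slope 1"
  shows "\<exists>!r. 0 < r \<and> r < 1 \<and> 1 - slope r = 0"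
proof -
  have "\<exists>r\<ge>0. r \<le> 1 \<and> slope r = 1"
    using assms by (intro IVT' continuous_intros) auto
  then obtain r where r: "0 \<le> r" "r \<le> 1" "slope r = 1" by blast
  then have "r \<noteq> 0" "r \<noteq> 1" using assms by auto
  with r have "0 < r \<and> r < 1 \<and> 1 - slope r = 0" by auto
  moreover have False if "0 < u" "u < v" "slope u = 1" "slope v = 1" for u v
    using slope_strict_mono[of u v] that by simp
  then have "u = v" if "0 < u" "0 < v" "slope u = 1" "slope v = 1" for u v
    using that by (metis linorder_neqE)
  ultimately show ?thesis
    by (intro ex1I[of _ r]) auto
qed

lemma rho_cases:
  obtains "slope 1 \<le> 1" "\<rho> = 1" | "0 < \<rho>" "\<rho> < 1" "slope \<rho> = 1"
proof (cases "slope 1 \<le> 1")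
  case True
  then show ?thesis using that(1) by (simp add: rho2_def slope_def)
next
  case False
  then have "\<rho> = (THE r. 0 < r \<and> r < 1 \<and> 1 - slope r = 0)"
    by (simp add: rho2_def slope_def)
  then have "0 < \<rho> \<and> \<rho> < 1 \<and> 1 - slope \<rho> = 0"
    using theI'[OF ex1_root] False by simp
  then show ?thesis using that(2) by simp
qed

lemma rho_pos: "0 < \<rho>"
  by (rule rho_cases) auto

lemma rho_le_1: "\<rho> \<le> 1"
  by (rule rho_cases) auto

lemma slope_rho_le: "slope \<rho> \<le> 1"
  by (rule rho_cases) auto

lemma slope_less_1:
  assumes "0 \<le> t" "t < \<rho>"
  shows "slope t < 1"
proof (rule rho_cases)
  show ?thesis if "0 < \<rho>" "\<rho> < 1" "slope \<rho> = 1"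
    using slope_strict_mono[of t \<rho>] assms that by simp
  show ?thesis if "slope 1 \<le> 1" "\<rho> = 1"
    using slope_strict_mono[of t 1] slope_scale[of t 1] assms that mult_nonneg_nonpos[of t "slope 1"]
    by (cases "0 < slope 1") auto
qed

text \<open>Since \<open>2 \<le> k + 1\<close>, twice the sum is at most \<open>t * slope t\<close>.
  This yields both the positivity of \<open>\<sigma>\<close> and the bound 3/2 for the modulus of
  \<open>log f\<close>.\<close>

lemma height_pert_le:
  assumes "0 \<le> t" "t \<le> \<rho>"
  shows "(\<Sum>k\<in>{1..<p}. Lam k * t ^ (k + 1)) \<le> t / 2"
proof -
  have "2 * (\<Sum>k\<in>{1..<p}. Lam k * t ^ (k + 1)) \<le> t * slope t"
    unfolding slope_def sum_distrib_left
  proof (rule sum_mono)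
    fix k assume k: "k \<in> {1..<p}"
    have "2 * (Lam k * t ^ (k + 1)) \<le> real (k + 1) * (Lam k * t ^ (k + 1))"
      using k Lam_nonneg[OF k] assms by (intro mult_right_mono) auto
    then show "2 * (Lam k * t ^ (k + 1)) \<le> t * (real (k + 1) * Lam k * t ^ k)"
      by (simp add: ac_simps)
  qed
  also have "\<dots> \<le> t * 1"
    using assms slope_less_1[of t] slope_rho_le
    by (intro mult_left_mono) (cases "t = \<rho>", auto)
  finally show ?thesis by simp
qed

lemma sigma_pos: "0 < \<sigma>"
  using height_pert_le[OF less_imp_le[OF rho_pos] order.refl] rho_pos
  unfolding sigma_eq height_def by linarith

end

section \<open>Injectivity and covering\<close>

text \<open>By invariance of domain the inverse is continuous on the image, so it carries the disk
  to an open connected set, which serves as the region.\<close>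

lemma contains_schlicht_diskI:
  assumes "open S" "continuous_on S f" "inj_on f S" "ball w r \<subseteq> f ` S" "0 < r"
  shows "contains_schlicht_disk f S w r"
proof -
  obtain g where g: "homeomorphism S (f ` S) f g"
    using invariance_of_domain_homeomorphism[OF assms(1,2) _ assms(3)] by auto
  have eq: "g ` ball w r = S \<inter> f -` ball w r"
    using homeomorphism_apply1[OF g] assms(4) by (auto simp: image_iff) force+
  have "open (g ` ball w r)"
    unfolding eq using assms by (intro continuous_open_preimage) auto
  moreover have "connected (g ` ball w r)"
    using continuous_on_subset[OF homeomorphism_cont2[OF g] assms(4)]
    by (intro connected_continuous_image) auto
  moreover have "f ` (g ` ball w r) = ball w r"
    unfolding eq using assms(4) by blast
  moreover have "g ` ball w r \<subseteq> S"
    unfolding eq by blast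
  ultimately show ?thesis
    unfolding contains_schlicht_disk_def using assms(3,5) by (metis inj_on_subset)
qed

lemma norm_power_diff_le:
  fixes z w :: complex
  assumes "norm z \<le> t" "norm w \<le> t"
  shows "norm (z ^ k - w ^ k) \<le> real k * t ^ (k - 1) * norm (z - w)"
proof (rule field_differentiable_bound[of "cball 0 t" "\<lambda>z. z ^ k" "\<lambda>z. of_nat k * z ^ (k - 1)"])
  fix z :: complex
  show "((\<lambda>z. z ^ k) has_field_derivative of_nat k * z ^ (k - 1)) (at z within cball 0 t)"
    by (auto intro!: derivative_eq_intros)
  assume "z \<in> cball 0 t"
  then show "norm (of_nat k * z ^ (k - 1)) \<le> real k * t ^ (k - 1)"
    by (auto simp: norm_mult norm_power intro!: mult_left_mono power_mono)
qed (use assms in auto)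

text \<open>Records what the estimates take from the logarithms with \<open>k \<ge> 1\<close>. The
  logarithm of index 0 is the identity and is built into \<open>logf\<close>.\<close>

locale landau_coefficients = landau_weights +
  fixes A :: "nat \<Rightarrow> complex \<Rightarrow> complex"
  assumes A_0: "k \<in> {1..<p} \<Longrightarrow> A k 0 = 0"
    and A_lipschitz: "\<lbrakk>k \<in> {1..<p}; z \<in> ball 0 1; w \<in> ball 0 1\<rbrakk>
      \<Longrightarrow> cmod (A k z - A k w) \<le> Lam k * cmod (z - w)"
begin

definition pert :: "complex \<Rightarrow> complex" where
  "pert z = (\<Sum>k\<in>{1..<p}. cnj z ^ k * A k z)"

definition logf :: "complex \<Rightarrow> complex" where
  "logf z = z + pert z"

lemma norm_A_le:
  assumes "k \<in> {1..<p}" "z \<in> ball 0 1"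
  shows "cmod (A k z) \<le> Lam k * cmod z"
  using A_lipschitz[of k z 0] A_0[of k] assms by simp

lemma norm_pert_le:
  assumes "z \<in> ball 0 1"
  shows "cmod (pert z) \<le> (\<Sum>k\<in>{1..<p}. Lam k * cmod z ^ (k + 1))"
  unfolding pert_def
proof (rule sum_norm_le)
  fix k assume k: "k \<in> {1..<p}"
  have "cmod (cnj z ^ k * A k z) \<le> cmod z ^ k * (Lam k * cmod z)"
    using norm_A_le[OF k assms] by (simp add: norm_mult norm_power mult_left_mono)
  then show "cmod (cnj z ^ k * A k z) \<le> Lam k * cmod z ^ (k + 1)"
    by (simp add: ac_simps)
qed

text \<open>Each difference of products splits in two: varying \<open>A k\<close> costs
  \<open>Lam k * t ^ k\<close>, and varying the power of the conjugate costs \<open>k\<close> times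
  as much, hence the factor \<open>k + 1\<close>.\<close>

lemma norm_pert_diff_le:
  assumes t: "t < 1" and z: "cmod z \<le> t" and w: "cmod w \<le> t"
  shows "cmod (pert z - pert w) \<le> slope t * cmod (z - w)"
  unfolding pert_def slope_def sum_distrib_right sum_subtractf[symmetric]
proof (rule sum_norm_le)
  fix k assume k: "k \<in> {1..<p}"
  have t0: "0 \<le> t" using z norm_ge_zero[of z] by linarith
  have "cmod (cnj z ^ k * (A k z - A k w)) \<le> t ^ k * (Lam k * cmod (z - w))"
    unfolding norm_mult using A_lipschitz[OF k, of z w] t z w t0
    by (intro mult_mono) (auto simp: norm_power intro: power_mono)
  moreover have "cmod ((cnj z ^ k - cnj w ^ k) * A k w)
      \<le> (real k * t ^ (k - 1) * cmod (z - w)) * (Lam k * t)"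
    unfolding norm_mult
  proof (intro mult_mono)
    have "cmod (cnj z - cnj w) = cmod (z - w)"
      by (metis complex_cnj_diff complex_mod_cnj)
    then show "cmod (cnj z ^ k - cnj w ^ k) \<le> real k * t ^ (k - 1) * cmod (z - w)"
      using norm_power_diff_le[of "cnj z" t "cnj w" k] z w by simp
    show "cmod (A k w) \<le> Lam k * t"
      using norm_A_le[OF k, of w] mult_left_mono[OF w Lam_nonneg[OF k]] t w by simp
  qed (use t0 in auto)
  moreover have "t ^ k = t * t ^ (k - 1)"
    using k by (cases k) auto
  moreover have "cnj z ^ k * A k z - cnj w ^ k * A k w
      = cnj z ^ k * (A k z - A k w) + (cnj z ^ k - cnj w ^ k) * A k w"
    by (simp add: algebra_simps)
  moreover have "cmod (cnj z ^ k * (A k z - A k w) + (cnj z ^ k - cnj w ^ k) * A k w)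
      \<le> cmod (cnj z ^ k * (A k z - A k w)) + cmod ((cnj z ^ k - cnj w ^ k) * A k w)"
    by (rule norm_triangle_ineq)
  ultimately show "cmod (cnj z ^ k * A k z - cnj w ^ k * A k w)
      \<le> real (k + 1) * Lam k * t ^ k * cmod (z - w)"
    by (simp add: algebra_simps)
qed

lemma continuous_on_logf: "continuous_on (ball 0 1) logf"
proof -
  have "continuous_on (ball 0 1) (A k)" if "k \<in> {1..<p}" for k
    using A_lipschitz[OF that] Lam_nonneg[OF that]
    by (intro lipschitz_on_continuous_on[of "Lam k"] lipschitz_onI) (auto simp: dist_norm)
  then show ?thesis
    unfolding logf_def[abs_def] pert_def[abs_def] by (intro continuous_intros) auto
qed

lemma inj_on_logf: "inj_on logf (ball 0 \<rho>)"
proof (rule inj_onI)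
  fix z w assume z: "z \<in> ball 0 \<rho>" and w: "w \<in> ball 0 \<rho>" and eq: "logf z = logf w"
  \<comment> \<open>Both points lie in a closed disk of radius strictly below \<open>\<rho>\<close>,
    where the Lipschitz constant is below 1; at \<open>\<rho>\<close> itself it may equal 1.\<close>
  define t where "t = max (cmod z) (cmod w)"
  have t: "0 \<le> t" "t < \<rho>" "cmod z \<le> t" "cmod w \<le> t"
    using z w by (auto simp: t_def le_max_iff_disj)
  have "w - z = pert z - pert w"
    using eq by (simp add: logf_def algebra_simps)
  then have "cmod (z - w) \<le> slope t * cmod (z - w)"
    using norm_pert_diff_le[of t z w] t rho_le_1 by (simp add: norm_minus_commute)
  then have "0 \<le> (slope t - 1) * cmod (z - w)"
    by (simp add: algebra_simps)
  then show "z = w"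
    using slope_less_1[OF t(1,2)] by (simp add: zero_le_mult_iff)
qed

lemma norm_logf_less_pi:
  assumes "z \<in> ball 0 \<rho>"
  shows "cmod (logf z) < pi"
proof -
  have "cmod (logf z) \<le> cmod z + cmod (pert z)"
    unfolding logf_def by (rule norm_triangle_ineq)
  also have "\<dots> \<le> cmod z + cmod z / 2"
    using norm_pert_le[of z] height_pert_le[of "cmod z"] assms rho_le_1 by simp
  also have "\<dots> < pi"
    using assms rho_le_1 pi_gt3 by simp
  finally show ?thesis .
qed

lemma inj_on_exp_logf: "inj_on (\<lambda>z. exp (logf z)) (ball 0 \<rho>)"
proof -
  have "inj_on exp (logf ` ball 0 \<rho>)"
    by (rule inj_on_subset[OF inj_on_exp_pi[of 0]]) (use norm_logf_less_pi in auto)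
  then show ?thesis
    using comp_inj_on[OF inj_on_logf] by (simp add: o_def)
qed

text \<open>A solution of \<open>logf z = w\<close> is a fixed point of \<open>z \<mapsto> w - pert z\<close>, which is a contraction of the
  closed disk of radius \<open>t\<close> as soon as \<open>cmod w \<le> height t\<close>.\<close>
lemma ball_subset_logf_image: "ball 0 \<sigma> \<subseteq> logf ` ball 0 \<rho>"
proof
  fix w :: complex assume "w \<in> ball 0 \<sigma>"
  then have w: "cmod w < height \<rho>" by (simp add: sigma_eq)
  then have "\<exists>t\<ge>0. t \<le> \<rho> \<and> height t = cmod w"
    using rho_pos by (intro IVT' continuous_intros) auto
  then obtain t where "0 \<le> t" "t \<le> \<rho>" and ht: "height t = cmod w" by blast
  \<comment> \<open>The strict inequality for \<open>w\<close> excludes \<open>t = \<rho>\<close>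
    and so secures a contraction constant below 1.\<close>
  with w have t: "0 \<le> t" "t < \<rho>"
    by (auto simp: order_le_less)
  then have t1: "t < 1" using rho_le_1 by linarith
  have "\<exists>!z\<in>cball 0 t. w - pert z = z"
  proof (rule Banach_fix)
    show "complete (cball (0::complex) t)" "cball (0::complex) t \<noteq> {}"
      using t by (auto intro: compact_imp_complete)
    show "0 \<le> slope t" "slope t < 1"
      using t by (auto intro: slope_nonneg slope_less_1)
    show "(\<lambda>z. w - pert z) ` cball 0 t \<subseteq> cball 0 t"
    proof (rule image_subsetI)
      fix z :: complex assume z: "z \<in> cball 0 t"
      have "cmod (pert z) \<le> (\<Sum>k\<in>{1..<p}. Lam k * cmod z ^ (k + 1))"
        using z t1 by (intro norm_pert_le) auto
      also have "\<dots> \<le> (\<Sum>k\<in>{1..<p}. Lam k * t ^ (k + 1))"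
        using z by (intro sum_mono mult_left_mono power_mono Lam_nonneg) auto
      finally have "cmod w + cmod (pert z) \<le> t"
        using ht by (simp add: height_def)
      then show "w - pert z \<in> cball 0 t"
        using norm_triangle_ineq4[of w "pert z"] by simp
    qed
    fix x y :: complex assume "x \<in> cball 0 t" "y \<in> cball 0 t"
    then show "dist (w - pert x) (w - pert y) \<le> slope t * dist x y"
      using norm_pert_diff_le[OF t1, of x y] by (simp add: dist_norm norm_minus_commute)
  qed
  then obtain z where "z \<in> cball 0 t" "w - pert z = z" by blast
  then have "z \<in> ball 0 \<rho>" "logf z = w"
    using t by (auto simp: logf_def algebra_simps)
  then show "w \<in> logf ` ball 0 \<rho>" by blast
qed

lemma landau_conclusion_exp_logf:
  assumes f: "\<And>z. z \<in> ball 0 1 \<Longrightarrow> f z = exp (logf z)"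
  shows "landau_conclusion p Lam f"
proof -
  have sub: "ball 0 \<rho> \<subseteq> ball (0::complex) 1"
    using rho_le_1 by (rule subset_ball)
  have eq: "f z = exp (logf z)" if "z \<in> ball 0 \<rho>" for z
    using f sub that by blast
  have inj: "inj_on f (ball 0 \<rho>)"
    using inj_on_exp_logf by (simp add: inj_on_def eq)
  have "contains_schlicht_disk f (ball 0 \<rho>) (w2 p Lam) (r2 p Lam)"
  proof (rule contains_schlicht_diskI[OF _ _ inj])
    have "continuous_on (ball 0 \<rho>) (\<lambda>z. exp (logf z))"
      by (intro continuous_intros continuous_on_subset[OF continuous_on_logf sub])
    then show "continuous_on (ball 0 \<rho>) f"
      by (rule continuous_on_eq) (simp add: eq)
    show "ball (w2 p Lam) (r2 p Lam) \<subseteq> f ` ball 0 \<rho>"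
    proof
      fix w assume w: "w \<in> ball (w2 p Lam) (r2 p Lam)"
      have "w \<noteq> 0" "Ln w \<in> ball 0 \<sigma>"
        using norm_Ln_less[of w \<sigma>] w by (simp_all add: w2_def r2_def)
      then obtain z where "z \<in> ball 0 \<rho>" "logf z = Ln w"
        using ball_subset_logf_image by (metis imageE subsetD)
      then have "z \<in> ball 0 \<rho>" "f z = w"
        using \<open>w \<noteq> 0\<close> by (simp_all add: eq)
      then show "w \<in> f ` ball 0 \<rho>" by blast
    qed
    show "0 < r2 p Lam"
      using sigma_pos by (simp add: r2_def)
  qed auto
  with inj show ?thesis
    by (simp add: landau_conclusion_def)
qed

end

section \<open>Normalised log-p-analytic functions\<close>

text \<open>The vanishing derivative is the Cauchy-Riemann equation
  \<open>D \<i> = \<i> * D 1\<close>, which makes the real-linear \<open>D\<close>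
  complex-linear.\<close>

lemma field_differentiable_if_wirtinger_zbar_0:
  assumes "f differentiable at z" "wirtinger_zbar f z = 0"
  shows "f field_differentiable at z"
proof -
  define D where "D = frechet_derivative f (at z)"
  have D: "(f has_derivative D) (at z)"
    using assms(1) by (simp add: D_def flip: frechet_derivative_works)
  interpret D: linear D
    by (rule has_derivative_linear[OF D])
  have "\<i> * (D 1 + \<i> * D \<i>) = 0"
    using assms(2) by (simp add: wirtinger_zbar_def D_def)
  then have Di: "D \<i> = \<i> * D 1"
    by (simp add: algebra_simps)
  have "D h = D 1 * h" for h
  proof -
    have h: "h = Re h *\<^sub>R 1 + Im h *\<^sub>R \<i>"
      by (simp add: complex_eq_iff)
    then have "D h = D (Re h *\<^sub>R 1 + Im h *\<^sub>R \<i>)"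
      by (rule arg_cong)
    also have "\<dots> = D 1 * (Re h *\<^sub>R 1 + Im h *\<^sub>R \<i>)"
      by (simp only: D.add D.scale Di) (simp add: scaleR_conv_of_real algebra_simps)
    also note h[symmetric]
    finally show ?thesis .
  qed
  then have "D = (*) (D 1)"
    by (rule ext)
  with D have "(f has_derivative (*) (D 1)) (at z)"
    by (rule has_derivative_eq_rhs)
  then show ?thesis
    unfolding field_differentiable_def has_field_derivative_def by (rule exI)
qed

text \<open>Two logarithms differ by a continuous function with values in the discrete set of
  multiples of \<open>2 * pi * \<i>\<close>, constant on a connected set and zero at 0. This
  identifies the analytic logarithm supplied by \<open>log_analytic_on\<close> with the given
  \<open>A\<close>.\<close>

lemma is_log_on_unique:
  assumes "connected D" "0 \<in> D" "is_log_on D f L" "is_log_on D f M" "z \<in> D"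
  shows "L z = M z"
proof -
  have "(\<lambda>z. L z - M z) constant_on D"
  proof (rule continuous_discrete_range_constant[OF assms(1)])
    show "continuous_on D (\<lambda>z. L z - M z)"
      using assms by (intro continuous_intros) (auto simp: is_log_on_def)
    have exp_eq_1: "exp (L x - M x) = 1" if "x \<in> D" for x
      using assms(3,4) that unfolding is_log_on_def by (metis diff_self exp_diff exp_zero)
    \<comment> \<open>Distinct values are at least \<open>2 * pi\<close> apart, so the gap 1
      suffices.\<close>
    have "L y - M y = L x - M x" if "x \<in> D" "y \<in> D" "cmod (L y - M y - (L x - M x)) < 1" for x y
    proof (rule exp_complex_eqI)
      show "exp (L y - M y) = exp (L x - M x)"
        using that by (simp add: exp_eq_1)
      show "\<bar>Im (L y - M y) - Im (L x - M x)\<bar> < 2 * pi"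
        using abs_Im_le_cmod[of "L y - M y - (L x - M x)"] that(3) pi_gt3 by simp
    qed
    then show "\<exists>e>0. \<forall>y. y \<in> D \<and> L y - M y \<noteq> L x - M x \<longrightarrow> e \<le> cmod (L y - M y - (L x - M x))"
      if "x \<in> D" for x
      using that by (metis not_le zero_less_one)
  qed
  then obtain c where "\<forall>z\<in>D. L z - M z = c"
    unfolding constant_on_def by blast
  moreover have "L 0 = M 0"
    using assms by (simp add: is_log_on_def)
  ultimately show ?thesis
    using assms(2,5) by (metis eq_iff_diff_eq_0)
qed

lemma holomorphic_on_log:
  assumes "open D" "connected D" "0 \<in> D" "log_analytic_on a D" "is_log_on D a A"
  shows "A holomorphic_on D"
proof -
  obtain L where L: "is_log_on D a L" "polyanalytic_on 1 L D"
    using assms(4) by (auto simp: log_polyanalytic_on_def)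
  have "L field_differentiable at z" if "z \<in> D" for z
  proof (rule field_differentiable_if_wirtinger_zbar_0)
    show "L differentiable at z" "wirtinger_zbar L z = 0"
      using L(2) that by (simp_all add: polyanalytic_on_def)
  qed
  then have "L holomorphic_on D"
    unfolding holomorphic_on_def by (blast intro: field_differentiable_at_within)
  then show ?thesis
    by (rule holomorphic_transform) (rule is_log_on_unique[OF assms(2,3) L(1) assms(5)])
qed

lemma eq_id_if_norm_deriv_le_1:
  assumes A: "A holomorphic_on ball 0 1" and "A 0 = 0" "deriv A 0 = 1"
    and le: "\<And>z. z \<in> ball 0 1 \<Longrightarrow> cmod (deriv A z) \<le> 1" and z: "z \<in> ball 0 1"
  shows "A z = z"
proof -
  have "deriv A constant_on ball 0 1"
  proof (rule maximum_modulus_principle[of _ "ball 0 1" "ball 0 1" 0])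
    show "deriv A holomorphic_on ball 0 1"
      using A open_ball by (rule holomorphic_deriv)
    show "cmod (deriv A x) \<le> cmod (deriv A 0)" if "x \<in> ball 0 1" for x
      using le[OF that] assms(3) by simp
  qed simp_all
  then obtain d where "\<forall>x\<in>ball 0 1. deriv A x = d"
    unfolding constant_on_def by blast
  then have deriv: "deriv A x = 1" if "x \<in> ball 0 1" for x
    using that assms(3) by simp
  have "((\<lambda>z. A z - z) has_field_derivative 0) (at x within ball 0 1)" if "x \<in> ball 0 1" for x
    using DERIV_diff[OF has_field_derivative_at_within[OF holomorphic_derivI[OF A open_ball that]] DERIV_ident]
    by (simp add: deriv[OF that])
  then have "\<exists>c. \<forall>x\<in>ball 0 1. A x - x = c"
    by (intro has_field_derivative_zero_constant) auto
  then obtain c where c: "\<And>x. x \<in> ball 0 1 \<Longrightarrow> A x - x = c" by blast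
  show ?thesis
    using c[OF z] c[of 0] assms(2) by simp
qed

text \<open>Carries the normalization, imposed on \<open>a\<close>, over to its logarithm, using
  \<open>exp (A 0) = a 0 = 1\<close>.\<close>

lemma deriv_exp_log:
  assumes "open D" "0 \<in> D" "A holomorphic_on D" "is_log_on D a A" "a 0 = 1"
  shows "deriv a 0 = deriv A 0"
proof -
  have "((\<lambda>z. exp (A z)) has_field_derivative exp (A 0) * deriv A 0) (at 0)"
    by (rule DERIV_chain2[OF DERIV_exp holomorphic_derivI[OF assms(3,1,2)]])
  then have "(a has_field_derivative exp (A 0) * deriv A 0) (at 0)"
    by (rule has_field_derivative_transform_within_open[OF _ assms(1,2)]) (use assms(4) in \<open>auto simp: is_log_on_def\<close>)
  then show ?thesis
    using assms(4,5) by (simp add: is_log_on_def DERIV_imp_deriv)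
qed

context landau_weights
begin

text \<open>Stated for every \<open>N\<close> containing 0 so as to serve both normalizations in the
  theorem.\<close>

lemma landau_conclusion_if_class:
  assumes p: "1 \<le> p" and cl: "landau_class N p Lam a A f" and N: "0 \<in> N"
  shows "landau_conclusion p Lam f"
proof -
  have logs: "log_analytic_on (a k) (ball 0 1)" "is_log_on (ball 0 1) (a k) (A k)" "a k 0 = 1"
    if "k < p" for k
    using cl that by (auto simp: landau_class_def)
  have holo: "A k holomorphic_on ball 0 1" if "k < p" for k
    by (rule holomorphic_on_log[OF _ _ _ logs(1,2)[OF that]]) auto
  have A0: "A k 0 = 0" if "k < p" for k
    using logs(2,3)[OF that] by (simp add: is_log_on_def)
  have Az: "A 0 z = z" if "z \<in> ball 0 1" for z
  proof (rule eq_id_if_norm_deriv_le_1[OF _ _ _ _ that])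
    have "deriv (a 0) 0 = deriv (A 0) 0"
      using p by (intro deriv_exp_log[of "ball 0 1"] holo logs) auto
    then show "deriv (A 0) 0 = 1"
      using cl N by (auto simp: landau_class_def)
    show "A 0 holomorphic_on ball 0 1" "A 0 0 = 0"
      using p holo A0 by simp_all
    show "cmod (deriv (A 0) x) \<le> 1" if "x \<in> ball 0 1" for x
      using cl that by (simp add: landau_class_def)
  qed
  interpret landau_coefficients p Lam A
  proof
    fix k assume k: "k \<in> {1..<p}"
    then show "A k 0 = 0" using A0 by auto
    fix z w :: complex assume "z \<in> ball 0 1" "w \<in> ball 0 1"
    then show "cmod (A k z - A k w) \<le> Lam k * cmod (z - w)"
    proof (intro field_differentiable_bound[of "ball 0 1" "A k" "deriv (A k)"])
      fix x :: complex assume x: "x \<in> ball 0 1"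
      show "(A k has_field_derivative deriv (A k) x) (at x within ball 0 1)"
        using k x holo[of k] by (auto intro: has_field_derivative_at_within holomorphic_derivI)
      show "cmod (deriv (A k) x) \<le> Lam k"
        using cl k x by (auto simp: landau_class_def)
    qed auto
  qed
  show ?thesis
  proof (rule landau_conclusion_exp_logf)
    fix z :: complex assume z: "z \<in> ball 0 1"
    have "f z = exp (\<Sum>k<p. cnj z ^ k * A k z)"
      using cl z by (auto simp: landau_class_def exp_sum)
    also have "(\<Sum>k<p. cnj z ^ k * A k z) = logf z"
      using p Az[OF z] by (simp add: logf_def pert_def lessThan_atLeast0 sum.atLeast_Suc_lessThan)
    finally show "f z = exp (logf z)" .
  qed
qed

end

section \<open>Extremal functions\<close>

lemma wirtinger_eqI:
  assumes "(f has_derivative (\<lambda>h. a * h + b * cnj h)) (at z)"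
  shows "wirtinger_z f z = a" "wirtinger_zbar f z = b"
proof -
  have *: "frechet_derivative f (at z) = (\<lambda>h. a * h + b * cnj h)"
    using frechet_derivative_at[OF assms] by (rule sym)
  show "wirtinger_z f z = a" "wirtinger_zbar f z = b"
    unfolding wirtinger_z_def wirtinger_zbar_def * by (simp_all add: algebra_simps)
qed

text \<open>The logarithm of a product whose \<open>A k\<close> are linear. This shape is preserved
  by \<open>wirtinger_zbar\<close>, which lowers the length by one.\<close>

definition cnj_poly :: "nat \<Rightarrow> (nat \<Rightarrow> complex) \<Rightarrow> complex \<Rightarrow> complex" where
  "cnj_poly n c z = (\<Sum>k<n. cnj z ^ k * (c k * z))"

lemma has_derivative_cnj_poly:
  "(cnj_poly n c has_derivative (\<lambda>h. (\<Sum>k<n. c k * cnj z ^ k) * h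
     + (\<Sum>k<n. of_nat k * c k * cnj z ^ (k - 1) * z) * cnj h)) (at z)"
proof -
  have "((\<lambda>z. cnj z ^ k * (c k * z)) has_derivative
      (\<lambda>h. c k * cnj z ^ k * h + of_nat k * c k * cnj z ^ (k - 1) * z * cnj h)) (at z)" for k
    by (rule has_derivative_eq_rhs,
        (rule has_derivative_mult has_derivative_power has_derivative_cnj has_derivative_const
          has_derivative_ident)+) (simp add: fun_eq_iff algebra_simps)
  then have "(cnj_poly n c has_derivative
      (\<lambda>h. \<Sum>k<n. c k * cnj z ^ k * h + of_nat k * c k * cnj z ^ (k - 1) * z * cnj h)) (at z)"
    unfolding cnj_poly_def[abs_def] by (intro has_derivative_sum)
  then show ?thesis
    by (simp add: sum.distrib sum_distrib_right)
qed

lemma wirtinger_zbar_cnj_poly: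
  "wirtinger_zbar (cnj_poly n c) = cnj_poly (n - 1) (\<lambda>k. of_nat (Suc k) * c (Suc k))"
proof
  fix z
  show "wirtinger_zbar (cnj_poly n c) z = cnj_poly (n - 1) (\<lambda>k. of_nat (Suc k) * c (Suc k)) z"
    unfolding wirtinger_eqI(2)[OF has_derivative_cnj_poly]
  proof (cases n)
    case (Suc m)
    show "(\<Sum>k<n. of_nat k * c k * cnj z ^ (k - 1) * z)
        = cnj_poly (n - 1) (\<lambda>k. of_nat (Suc k) * c (Suc k)) z"
      unfolding Suc sum.lessThan_Suc_shift
      by (simp add: cnj_poly_def ac_simps del: sum.lessThan_Suc of_nat_Suc)
  qed (simp add: cnj_poly_def)
qed

text \<open>After \<open>n\<close> applications of \<open>wirtinger_zbar\<close> the sum is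
  empty.\<close>

lemma polyanalytic_on_cnj_poly: "polyanalytic_on n (cnj_poly n c) D"
proof -
  have ex: "\<exists>d. (wirtinger_zbar ^^ j) (cnj_poly n c) = cnj_poly (n - j) d" for j
  proof (induction j)
    case (Suc j)
    then obtain d where "(wirtinger_zbar ^^ j) (cnj_poly n c) = cnj_poly (n - j) d" by blast
    then show ?case by (auto simp: wirtinger_zbar_cnj_poly)
  qed auto
  show ?thesis
    unfolding polyanalytic_on_def
  proof (intro conjI allI impI ballI)
    show "continuous_on D (cnj_poly n c)"
      unfolding cnj_poly_def[abs_def] by (intro continuous_intros)
    show "(wirtinger_zbar ^^ j) (cnj_poly n c) differentiable at z" for j z
    proof -
      obtain d where "(wirtinger_zbar ^^ j) (cnj_poly n c) = cnj_poly (n - j) d"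
        using ex by blast
      then show ?thesis
        using differentiableI[OF has_derivative_cnj_poly[of "n - j" d z]] by (simp only:)
    qed
    show "(wirtinger_zbar ^^ n) (cnj_poly n c) z = 0" for z
      using ex[of n] by (auto simp: cnj_poly_def)
  qed
qed

lemma is_log_on_exp: "continuous_on D L \<Longrightarrow> L 0 = 0 \<Longrightarrow> is_log_on D (\<lambda>z. exp (L z)) L"
  by (simp add: is_log_on_def)

text \<open>Were \<open>y\<close> attained, continuity of the inverse would make \<open>x\<close>
  converge to a point of \<open>S\<close>, whereas its limit \<open>b\<close> lies outside.\<close>

lemma boundary_value_notin_image:
  fixes f :: "complex \<Rightarrow> complex"
  assumes "open S" "continuous_on S f" "inj_on f S" and x: "\<And>n. x n \<in> S" "x \<longlonglongrightarrow> b"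
    and b: "b \<notin> S" and y: "(\<lambda>n. f (x n)) \<longlonglongrightarrow> y"
  shows "y \<notin> f ` S"
proof
  assume yS: "y \<in> f ` S"
  obtain g where g: "homeomorphism S (f ` S) f g"
    using invariance_of_domain_homeomorphism[OF assms(1,2) _ assms(3)] by auto
  have "(\<lambda>n. g (f (x n))) \<longlonglongrightarrow> g y"
    using x(1) by (intro continuous_on_tendsto_compose[OF homeomorphism_cont2[OF g] y yS]) auto
  then have "x \<longlonglongrightarrow> g y"
    by (simp add: homeomorphism_apply1[OF g x(1)])
  then have "g y = b"
    using x(2) LIMSEQ_unique by blast
  moreover have "g y \<in> S"
    using homeomorphism_image2[OF g] yS by blast
  ultimately show False using b by simp
qed

context landau_weights
begin

text \<open>Past \<open>\<rho>\<close> the derivative \<open>1 - slope t\<close> is negative, so the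
  value at \<open>\<rho>\<close> exceeds those at both ends, while a continuous injection on an
  interval is monotone.\<close>

lemma not_inj_on_height:
  assumes "\<rho> < u" "u \<le> 1"
  shows "\<not> inj_on height {0..u}"
proof
  assume inj: "inj_on height {0..u}"
  have slope: "slope \<rho> = 1"
    by (rule rho_cases) (use assms in auto)
  have "height u < height \<rho>"
  proof (rule DERIV_neg_imp_decreasing_open[OF assms(1)])
    fix t assume t: "\<rho> < t" "t < u"
    \<comment> \<open>Scaling from \<open>slope \<rho> = 1\<close> gives
      \<open>slope t \<ge> t / \<rho> > 1\<close>.\<close>
    have "t \<le> \<rho> * slope t"
      using slope_scale[of \<rho> t] rho_pos t slope by simp
    moreover have "\<rho> * slope t \<le> \<rho>" if "slope t \<le> 1"
      using that rho_pos by (simp add: mult_left_le)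
    ultimately have "1 - slope t < 0"
      using t by force
    then show "\<exists>y. (height has_real_derivative y) (at t) \<and> y < 0"
      using has_real_derivative_height by blast
  qed (rule continuous_on_height)
  moreover have "height 0 < height \<rho>"
    using sigma_pos by (simp add: sigma_eq)
  ultimately show False
    using continuous_inj_imp_mono[OF rho_pos assms(1) continuous_on_height inj] by linarith
qed

text \<open>At \<open>z = s * t\<close> with \<open>\<bar>s\<bar> = 1\<close> the factor
  \<open>s ^ k\<close> cancels the one from \<open>cnj z ^ k\<close>, so every term with
  \<open>k \<ge> 1\<close> becomes \<open>- s * Lam k * t ^ (k + 1)\<close>.\<close>

definition ray_coeff :: "real \<Rightarrow> nat \<Rightarrow> real" where
  "ray_coeff s k = (if k = 0 then 1 else - Lam k * s ^ k)"

definition extremal :: "real \<Rightarrow> complex \<Rightarrow> complex" where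
  "extremal s z = exp (cnj_poly p (\<lambda>k. of_real (ray_coeff s k)) z)"

text \<open>The sign \<open>s\<close> selects the ray on which the logarithm of the extremal function
  is as small as the bounds on the coefficients permit.\<close>
lemma extremal_of_real:
  assumes "1 \<le> p" "\<bar>s\<bar> = 1"
  shows "extremal s (of_real (s * t)) = exp (of_real (s * height t))"
proof -
  have "s * s = 1"
    using assms(2) by (metis abs_mult_self mult_1)
  then have ss: "s ^ k * s ^ k = 1" for k
    by (simp flip: power_mult_distrib)
  have "cnj_poly p (\<lambda>k. of_real (ray_coeff s k)) (of_real (s * t))
      = of_real (\<Sum>k<p. (s * t) ^ k * (ray_coeff s k * (s * t)))"
    by (simp add: cnj_poly_def)
  also have "(\<Sum>k<p. (s * t) ^ k * (ray_coeff s k * (s * t)))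
      = s * t + (\<Sum>k\<in>{1..<p}. (s * t) ^ k * (- Lam k * s ^ k * (s * t)))"
    using assms(1) by (simp add: lessThan_atLeast0 sum.atLeast_Suc_lessThan ray_coeff_def)
  also have "(\<Sum>k\<in>{1..<p}. (s * t) ^ k * (- Lam k * s ^ k * (s * t)))
      = (\<Sum>k\<in>{1..<p}. - s * (Lam k * t ^ (k + 1)))"
  proof (rule sum.cong[OF refl])
    fix k
    have "(s * t) ^ k * (- Lam k * s ^ k * (s * t)) = - s * (Lam k * t ^ (k + 1)) * (s ^ k * s ^ k)"
      by (simp add: power_mult_distrib)
    then show "(s * t) ^ k * (- Lam k * s ^ k * (s * t)) = - s * (Lam k * t ^ (k + 1))"
      by (simp add: ss)
  qed
  also have "s * t + \<dots> = s * height t"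
    by (simp add: height_def right_diff_distrib sum_negf flip: sum_distrib_left)
  finally show ?thesis by (simp add: extremal_def)
qed

lemma landau_class_extremal:
  assumes p: "1 \<le> p" and s: "\<bar>s\<bar> = 1" and N: "\<And>k. k \<in> N \<Longrightarrow> ray_coeff s k = 1"
  shows "landau_class N p Lam (\<lambda>k z. exp (of_real (ray_coeff s k) * z))
    (\<lambda>k z. of_real (ray_coeff s k) * z) (extremal s)"
proof -
  let ?c = "\<lambda>k. complex_of_real (ray_coeff s k)"
  have cont: "continuous_on D (cnj_poly p ?c)" for D
    unfolding cnj_poly_def[abs_def] by (intro continuous_intros)
  have log: "is_log_on D (\<lambda>z. exp (c * z)) (\<lambda>z. c * z)" for D and c :: complex
    by (intro is_log_on_exp continuous_intros) simp
  have "polyanalytic_on 1 (\<lambda>z. c * z) D" for c D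
    using polyanalytic_on_cnj_poly[of 1 "\<lambda>_. c" D] by (simp add: cnj_poly_def[abs_def])
  with log have an: "log_analytic_on (\<lambda>z. exp (c * z)) D" for c D
    unfolding log_polyanalytic_on_def by blast
  have "(extremal s has_derivative (\<lambda>h. 1 * h + 0 * cnj h)) (at 0)"
  proof -
    have "(\<Sum>k<p. ?c k * cnj 0 ^ k) = 1"
      using p by (simp add: lessThan_atLeast0 sum.atLeast_Suc_lessThan ray_coeff_def)
    then have "(cnj_poly p ?c has_derivative (\<lambda>h. h)) (at 0)"
      using has_derivative_cnj_poly[of p ?c 0] by simp
    then have "((\<lambda>z. exp (cnj_poly p ?c z)) has_derivative (\<lambda>h. exp (cnj_poly p ?c 0) * h)) (at 0)"
      by (rule has_derivative_compose[OF _ has_field_derivative_imp_has_derivative[OF DERIV_exp]])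
    then show ?thesis
      by (simp add: extremal_def[abs_def] cnj_poly_def)
  qed
  then have lambda: "lambda_f (extremal s) 0 = 1"
    unfolding lambda_f_def by (simp only: wirtinger_eqI) simp
  have "is_log_on (ball 0 1) (extremal s) (cnj_poly p ?c)"
    unfolding extremal_def[abs_def] by (intro is_log_on_exp cont) (simp add: cnj_poly_def)
  then have log_f: "log_polyanalytic_on p (extremal s) (ball 0 1)"
    using polyanalytic_on_cnj_poly unfolding log_polyanalytic_on_def by blast
  have f: "extremal s z = (\<Prod>k<p. exp (cnj z ^ k * (?c k * z)))" for z
    by (simp add: extremal_def cnj_poly_def exp_sum)
  have f0: "extremal s 0 = 1"
    by (simp add: extremal_def cnj_poly_def)
  have "(exp \<circ> (*) c has_field_derivative c) (at 0)" for c :: complex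
    by (auto intro!: derivative_eq_intros simp: o_def)
  then have da: "deriv (\<lambda>z. exp (c * z)) 0 = c" for c :: complex
    by (simp add: o_def DERIV_imp_deriv)
  have dA: "deriv (\<lambda>z. c * z) z = c" for c z :: complex
    by (rule DERIV_imp_deriv[OF DERIV_cmult_Id])
  have "\<bar>ray_coeff s k\<bar> = Lam k" if "k \<in> {1..<p}" for k
    using that s Lam_nonneg[OF that] by (simp add: ray_coeff_def abs_mult power_abs)
  then have le: "cmod (deriv (\<lambda>z. ?c k * z) z) \<le> Lam k" if "k \<in> {1..<p}" for k z
    unfolding dA norm_of_real using that by simp
  have le0: "cmod (deriv (\<lambda>z. ?c 0 * z) z) \<le> 1" for z
    unfolding dA norm_of_real by (simp add: ray_coeff_def)
  have dN: "deriv (\<lambda>z. exp (?c k * z)) 0 = 1" if "k \<in> N" for k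
    unfolding da N[OF that] by simp
  have "exp (?c k * 0) = 1" for k
    by simp
  then show ?thesis
    unfolding landau_class_def
    using log_f f f0 lambda an log dN le le0 by blast
qed

text \<open>On the ray the function is \<open>exp (s * height t)\<close>. Injectivity fails beyond
  \<open>\<rho>\<close> together with that of \<open>height\<close>, and the boundary value
  \<open>exp (s * \<sigma>)\<close>, an end of the diameter of the covered disk, is omitted.\<close>

lemma landau_extremal_extremal:
  assumes p: "1 \<le> p" and s: "\<bar>s\<bar> = 1" and inj: "inj_on (extremal s) (ball 0 \<rho>)"
  shows "landau_extremal p Lam (extremal s)"
  unfolding landau_extremal_def
proof (intro conjI allI impI)
  fix r assume r: "\<rho> < r \<and> r \<le> 1"
  show "\<not> inj_on (extremal s) (ball 0 r)"
  proof
    assume inj: "inj_on (extremal s) (ball 0 r)"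
    \<comment> \<open>The closed segment up to \<open>u\<close> then fits into the open disk of
      radius \<open>r\<close>.\<close>
    obtain u where u: "\<rho> < u" "u < r"
      using r dense by blast
    have "inj_on height {0..u}"
    proof (rule inj_onI)
      fix t t' assume t: "t \<in> {0..u}" "t' \<in> {0..u}" "height t = height t'"
      then have "extremal s (of_real (s * t)) = extremal s (of_real (s * t'))"
        by (simp only: extremal_of_real[OF p s])
      moreover have "complex_of_real (s * t) \<in> ball 0 r" "complex_of_real (s * t') \<in> ball 0 r"
        using t s u by (simp_all add: norm_mult)
      ultimately have "complex_of_real (s * t) = of_real (s * t')"
        by (rule inj_onD[OF inj])
      then show "t = t'" using s by auto
    qed
    then show False
      using not_inj_on_height[of u] u r by linarith
  qed
next
  fix r assume r: "r2 p Lam < r"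
  have cont: "continuous_on D (extremal s)" for D
    unfolding extremal_def[abs_def] cnj_poly_def by (intro continuous_intros)
  define x where "x n = complex_of_real (s * (\<rho> * (real n / real (Suc n))))" for n
  define b where "b = complex_of_real (s * \<rho>)"
  have "(\<lambda>n. s * (\<rho> * (real n / real (Suc n)))) \<longlonglongrightarrow> s * (\<rho> * 1)"
    by (intro tendsto_mult tendsto_const LIMSEQ_n_over_Suc_n)
  then have x: "x \<longlonglongrightarrow> b"
    unfolding x_def[abs_def] b_def mult_1_right by (rule tendsto_of_real)
  have "extremal s b \<notin> extremal s ` ball 0 \<rho>"
  proof (rule boundary_value_notin_image[OF open_ball cont inj _ x])
    show "x n \<in> ball 0 \<rho>" for n
    proof -
      have "\<rho> * (real n / real (Suc n)) < \<rho> * 1"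
        using rho_pos by (intro mult_strict_left_mono) auto
      moreover have "\<bar>\<rho> * (real n / real (Suc n))\<bar> = \<rho> * (real n / real (Suc n))"
        using rho_pos by (intro abs_of_nonneg mult_nonneg_nonneg divide_nonneg_nonneg) auto
      ultimately show ?thesis
        unfolding x_def mem_ball_0 norm_of_real abs_mult[of s] s by linarith
    qed
    show "b \<notin> ball 0 \<rho>"
      using s rho_pos by (simp add: b_def norm_mult)
    show "(\<lambda>n. extremal s (x n)) \<longlonglongrightarrow> extremal s b"
      by (rule continuous_on_tendsto_compose[OF cont[of UNIV] x]) auto
  qed
  moreover have "extremal s b \<in> ball (w2 p Lam) r"
  proof -
    \<comment> \<open>For either sign, \<open>exp (s * \<sigma>)\<close> is at distance exactly
      \<open>sinh \<sigma>\<close>, the covered radius, from the centre.\<close>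
    have "s = 1 \<or> s = - 1"
      using s by linarith
    then have "cosh \<sigma> - exp (s * \<sigma>) = - s * sinh \<sigma>"
      using cosh_plus_sinh[of \<sigma>] cosh_minus_sinh[of \<sigma>] by auto
    moreover have "dist (w2 p Lam) (extremal s b) = \<bar>cosh \<sigma> - exp (s * \<sigma>)\<bar>"
      by (simp only: b_def extremal_of_real[OF p s] w2_def dist_norm sigma_eq exp_of_real
          of_real_diff[symmetric] norm_of_real)
    ultimately show ?thesis
      using s r sigma_pos by (simp add: r2_def abs_mult)
  qed
  ultimately show "\<not> ball (w2 p Lam) r \<subseteq> extremal s ` ball 0 \<rho>"
    by blast
qed

lemma ex_extremal:
  assumes "1 \<le> p" "\<bar>s\<bar> = 1" "0 \<in> N" "\<And>k. k \<in> N \<Longrightarrow> ray_coeff s k = 1"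
  shows "\<exists>a A f. landau_class N p Lam a A f \<and> landau_extremal p Lam f"
proof -
  note cls = landau_class_extremal[OF assms(1,2,4)]
  \<comment> \<open>The positive result, applied to the extremal function, supplies the injectivity
    for the boundary argument.\<close>
  then have "inj_on (extremal s) (ball 0 \<rho>)"
    using landau_conclusion_if_class[OF assms(1) cls assms(3)] by (simp add: landau_conclusion_def)
  then show ?thesis
    using cls landau_extremal_extremal[OF assms(1,2)] by blast
qed

end

theorem theorem6:
  fixes p :: nat and Lam :: "nat \<Rightarrow> real"
  assumes "1 \<le> p"
    and "\<forall>k\<in>{1..<p}. 0 \<le> Lam k"
  shows
    "(1 < (\<Sum>k\<in>{1..<p}. real (k + 1) * Lam k) \<longrightarrow>
        (\<exists>!r. 0 < r \<and> r < 1 \<and> 1 - (\<Sum>k\<in>{1..<p}. real (k + 1) * Lam k * r ^ k) = 0)) \<and>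
     (\<forall>a A f. landau_class {..<p} p Lam a A f \<longrightarrow> landau_conclusion p Lam f) \<and>
     (p = 1 \<or> p = 2 \<and> Lam 1 = 1 \<longrightarrow>
        (\<exists>a A f. landau_class {..<p} p Lam a A f \<and> landau_extremal p Lam f)) \<and>
     (\<forall>a A f. landau_class {0} p Lam a A f \<longrightarrow> landau_conclusion p Lam f) \<and>
     (\<exists>a A f. landau_class {0} p Lam a A f \<and> landau_extremal p Lam f)"
proof -
  interpret landau_weights p Lam
    by (rule landau_weights.intro) (use assms(2) in blast)
  show ?thesis
  proof (intro conjI impI allI)
    assume "1 < (\<Sum>k\<in>{1..<p}. real (k + 1) * Lam k)"
    then have "1 < slope 1"
      by (simp add: slope_def)
    from ex1_root[OF this]
    show "\<exists>!r. 0 < r \<and> r < 1 \<and> 1 - (\<Sum>k\<in>{1..<p}. real (k + 1) * Lam k * r ^ k) = 0"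
      unfolding slope_def .
  next
    fix a A f assume "landau_class {..<p} p Lam a A f"
    from landau_conclusion_if_class[OF assms(1) this] show "landau_conclusion p Lam f"
      using assms(1) by simp
  next
    assume p: "p = 1 \<or> p = 2 \<and> Lam 1 = 1"
    \<comment> \<open>All coefficients must be 1 here. The sign -1 turns the coefficient of index 1
      into \<open>Lam 1 = 1\<close>.\<close>
    have coeff: "ray_coeff (- 1) k = 1" if "k \<in> {..<p}" for k
    proof -
      have "k = 0 \<or> k = 1 \<and> Lam 1 = 1"
        using p that by auto
      then show ?thesis by (auto simp: ray_coeff_def)
    qed
    show "\<exists>a A f. landau_class {..<p} p Lam a A f \<and> landau_extremal p Lam f"
      using assms(1) by (intro ex_extremal[OF assms(1) _ _ coeff]) simp_all
  next
    fix a A f assume "landau_class {0} p Lam a A f"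
    from landau_conclusion_if_class[OF assms(1) this] show "landau_conclusion p Lam f"
      by simp
  next
    \<comment> \<open>The constrained coefficient has index 0 and equals 1 for either sign; the
      positive ray is taken.\<close>
    show "\<exists>a A f. landau_class {0} p Lam a A f \<and> landau_extremal p Lam f"
      by (rule ex_extremal[OF assms(1), of 1]) (simp_all add: ray_coeff_def)
  qed
qed

end
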